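(* Let $m\ge 1$ and let $(S^1,S^2,\ldots,S^m)$ be a position of Star Silver Dollar, where $S^i=[a^i_1,\ldots,a^i_{k_i}]$ with $k_i\ge 1$. For each $i$ set $S^i_H=[a^i_1]$ and $S^i_T=[a^i_2,\ldots,a^i_{k_i}]$ if $k_i$ is odd, and $S^i_H=[a^i_1,a^i_2]$ and $S^i_T=[a^i_3,\ldots,a^i_{k_i}]$ if $k_i$ is even (so $S^i_T$ may be empty). Then $$\mathcal{G}(S^1,S^2,\ldots,S^m)=\mathcal{G}(S^1_H,S^2_H,\ldots,S^m_H)\oplus\mathcal{G}(S^1_T)\oplus\mathcal{G}(S^2_T)\oplus\cdots\oplus\mathcal{G}(S^m_T),$$ where $\mathcal{G}(S^1,\ldots,S^m)$ and $\mathcal{G}(S^1_H,\ldots,S^m_H)$ are Sprague-Grundy values of Star Silver Dollar positions and each $\mathcal{G}(S^i_T)$ is the Sprague-Grundy value of a (separate, single-strip) Silver Dollar position. That is, as far as Sprague-Grundy values are concerned, the game $(S^1,\ldots,S^m)$ is the disjunctive sum of the Star Silver Dollar game $(S^1_H,\ldots,S^m_H)$ and the Silver Dollar games $S^1_T,\ldots,S^m_T$.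
   Context: Silver Dollar: a position $[a_1,\ldots,a_k]$ is a strictly increasing finite sequence of nonnegative integers (the squares occupied by tokens on a strip with squares $0,1,2,\ldots$). A move replaces some $a_j$ by an integer $c$ with $a_{j-1}<c<a_j$ (with $0\le c<a_1$ if $j=1$): a token moves to a smaller empty square without jumping over another token. The empty position has no moves. Star Silver Dollar with $m$ strips: the squares $0$ of $m$ strips are identified into a single shared square. A position $(S^1,\ldots,S^m)$ consists of $m$ Silver Dollar positions $S^i=[a^i_1,\ldots,a^i_{k_i}]$ such that at most one of the $S^i$ has a token on square $0$ (each square, including the shared square $0$, holds at most one token). A move is a Silver Dollar move in one of the strips whose result is again a legal position (so a token may move to square $0$ only if square $0$ is unoccupied). Both games are impartial games; a player unable to move loses. $\mathcal{G}$ is the Sprague-Grundy value: $\mathcal{G}(p)=\operatorname{mex}\{\mathcal{G}(q): q \text{ reachable from } p \text{ in one move}\}$, where $\operatorname{mex}(S)$ is the least nonnegative integer not in $S$. $\oplus$ is Nim-sum (bitwise addition mod 2 of binary representations). *)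

theory Defs
  imports Main
begin

section \<open>Impartial games and Sprague-Grundy values\<close>

text \<open>
  An impartial game is given by its options function: \<open>opts p\<close> is the set of positions reachable
  from \<open>p\<close> in one move.
\<close>

definition mex :: "nat set \<Rightarrow> nat" where
  "mex A = (LEAST n. n \<notin> A)"

text \<open>
  The recursion is meaningful for terminating games only; for these the defining equation of the
  Sprague-Grundy value is \<open>grundy_eq\<close> below.
\<close>

definition grundy :: "('p \<Rightarrow> 'p set) \<Rightarrow> 'p \<Rightarrow> nat" where
  "grundy opts = wfrec {(q, p). q \<in> opts p} (\<lambda>g p. mex (g ` opts p))"

lemma grundy_eq:
  assumes "wf {(q, p). q \<in> opts p}"
  shows "grundy opts p = mex (grundy opts ` opts p)"
proof -
  let ?R = "{(q, p). q \<in> opts p}"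
  have "grundy opts p = mex (cut (grundy opts) ?R p ` opts p)"
    unfolding grundy_def by (subst wfrec[OF assms]) simp
  also have "cut (grundy opts) ?R p ` opts p = grundy opts ` opts p"
    by (rule image_cong) (auto simp: cut_apply)
  finally show ?thesis .
qed

definition nim_sum :: "nat list \<Rightarrow> nat" where
  "nim_sum xs = foldr Bit_Operations.xor xs 0"

text \<open>Disjunctive sum of two games, and of a list of positions of the same game.\<close>

definition sum_opts :: "('p \<Rightarrow> 'p set) \<Rightarrow> ('q \<Rightarrow> 'q set) \<Rightarrow> 'p \<times> 'q \<Rightarrow> ('p \<times> 'q) set" where
  "sum_opts f g = (\<lambda>(p, q). {(p', q) |p'. p' \<in> f p} \<union> {(p, q') |q'. q' \<in> g q})"

definition sum_list_opts :: "('p \<Rightarrow> 'p set) \<Rightarrow> 'p list \<Rightarrow> 'p list set" where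
  "sum_list_opts f ps = {ps[i := p'] |i p'. i < length ps \<and> p' \<in> f (ps ! i)}"

section \<open>Silver Dollar\<close>

definition sd_position :: "nat list \<Rightarrow> bool" where
  "sd_position a \<longleftrightarrow> sorted_wrt (<) a"

definition sd_opts :: "nat list \<Rightarrow> nat list set" where
  "sd_opts a =
    {a[j := c] |j c. j < length a \<and> c < a ! j \<and> (j > 0 \<longrightarrow> a ! (j - 1) < c)}"

section \<open>Star Silver Dollar\<close>

text \<open>The number of strips is the length of the outer list.\<close>

definition ssd_position :: "nat list list \<Rightarrow> bool" where
  "ssd_position S \<longleftrightarrow>
    (\<forall>s \<in> set S. sd_position s) \<and> card {i. i < length S \<and> 0 \<in> set (S ! i)} \<le> 1"

definition ssd_opts :: "nat list list \<Rightarrow> nat list list set" where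
  "ssd_opts S =
    {S[i := s] |i s. i < length S \<and> s \<in> sd_opts (S ! i) \<and> ssd_position (S[i := s])}"

definition strip_head :: "nat list \<Rightarrow> nat list" where
  "strip_head s = take (if odd (length s) then 1 else 2) s"

definition strip_tail :: "nat list \<Rightarrow> nat list" where
  "strip_tail s = drop (if odd (length s) then 1 else 2) s"

section \<open>Well-definedness of the Sprague-Grundy values\<close>

lemma sum_list_update_less:
  fixes f :: "'a \<Rightarrow> nat"
  assumes "i < length xs" "f y < f (xs ! i)"
  shows "sum_list (map f (xs[i := y])) < sum_list (map f xs)"
  using assms by (induction xs arbitrary: i) (auto split: nat.split)

lemma sd_opts_less:
  assumes "b \<in> sd_opts a"
  shows "sum_list b < sum_list a"
  using assms sum_list_update_less[where f = id] by (auto simp: sd_opts_def)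

lemma sum_list_sd_less:
  assumes "i < length S" "b \<in> sd_opts (S ! i)"
  shows "sum_list (map sum_list (S[i := b])) < sum_list (map sum_list S)"
  using assms by (intro sum_list_update_less sd_opts_less)

lemma wf_sd_opts: "wf {(q, p). q \<in> sd_opts p}"
  by (rule wf_subset[OF wf_measure[of sum_list]]) (auto dest: sd_opts_less)

lemma wf_ssd_opts: "wf {(q, p). q \<in> ssd_opts p}"
proof (rule wf_subset[OF wf_measure[of "\<lambda>S. sum_list (map sum_list S)"]], clarify)
  fix T S assume "T \<in> ssd_opts S"
  then show "(T, S) \<in> measure (\<lambda>S. sum_list (map sum_list S))"
    by (auto simp: ssd_opts_def sum_list_sd_less)
qed

lemma wf_sum_opts:
  "wf {(q, p). q \<in> sum_opts ssd_opts (sum_list_opts sd_opts) p}"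
proof (rule wf_subset[OF wf_measure[of
      "\<lambda>(S, ts). sum_list (map sum_list S) + sum_list (map sum_list ts)"]], clarify)
  fix S' ts' S ts
  assume "(S', ts') \<in> sum_opts ssd_opts (sum_list_opts sd_opts) (S, ts)"
  then show "((S', ts'), (S, ts)) \<in>
      measure (\<lambda>(S, ts). sum_list (map sum_list S) + sum_list (map sum_list ts))"
    by (auto simp: sum_opts_def sum_list_opts_def ssd_opts_def sum_list_sd_less)
qed

lemma finite_update:
  assumes "\<And>i. i < length xs \<Longrightarrow> finite (F i)"
  shows "finite {xs[i := y] |i y. i < length xs \<and> y \<in> F i}"
proof -
  have "{xs[i := y] |i y. i < length xs \<and> y \<in> F i} = (\<Union>i<length xs. (\<lambda>y. xs[i := y]) ` F i)"
    by auto
  then show ?thesis using assms by simp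
qed

lemma finite_sd_opts: "finite (sd_opts a)"
proof (rule finite_subset)
  show "sd_opts a \<subseteq> {a[j := c] |j c. j < length a \<and> c \<in> {..<a ! j}}"
    by (auto simp: sd_opts_def)
  show "finite {a[j := c] |j c. j < length a \<and> c \<in> {..<a ! j}}"
    by (rule finite_update) simp
qed

lemma finite_ssd_opts: "finite (ssd_opts S)"
proof (rule finite_subset)
  show "ssd_opts S \<subseteq> {S[i := s] |i s. i < length S \<and> s \<in> sd_opts (S ! i)}"
    by (auto simp: ssd_opts_def)
qed (simp add: finite_update finite_sd_opts)

lemma finite_sum_opts: "finite (sum_opts ssd_opts (sum_list_opts sd_opts) P)"
proof (cases P)
  case (Pair S ts)
  have "finite (sum_list_opts sd_opts ts)"
    unfolding sum_list_opts_def by (intro finite_update finite_sd_opts)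
  then show ?thesis
    by (simp add: Pair sum_opts_def finite_ssd_opts)
qed

end

theory Submission
  imports Defs
begin

text \<open>
  Let \<open>gap_sum\<close> be the Nim-sum of the gaps between consecutive tokens paired up from the right.
  The value \<open>\<G>(S\<^sub>H)\<close> combined with the \<open>gap_sum\<close> of each tail satisfies the mex recursion on
  \<open>S\<close>. Every move of \<open>S\<close> changes exactly one of these components. Conversely, every option of
  \<open>S\<^sub>H\<close> is available in \<open>S\<close>, since head tokens only move away from the tails, and every smaller
  gap can be reached by moving the right token of its pair, which the head does not obstruct.
\<close>

section \<open>Nim-sums and Sprague-Grundy values\<close>

unbundle bit_operations_syntax

lemma less_div_2_iff:
  fixes a b :: nat
  shows "a < b \<longleftrightarrow> a div 2 < b div 2 \<or> a div 2 = b div 2 \<and> even a \<and> odd b"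
  by presburger

text \<open>The usual Nim argument: at the highest bit where \<open>v\<close> and
  \<open>a XOR b\<close> differ, exactly one of \<open>a\<close> and \<open>b\<close> has a 1, and
  XORing that one with \<open>v XOR a XOR b\<close> lowers it. The induction peels off lowest bits
  instead of locating that bit.\<close>

lemma xor_less_cases:
  fixes a b v :: nat
  assumes "v < a XOR b"
  shows "v XOR b < a \<or> a XOR v < b"
  using assms
proof (induction "a + b" arbitrary: a b v rule: less_induct)
  case less
  show ?case
  proof (cases "a = 0 \<or> b = 0")
    case True
    then show ?thesis using less.prems by auto
  next
    case False
    have div2: "(x XOR y) div 2 = (x div 2) XOR (y div 2)" for x y :: nat
      by (simp add: bit_eq_iff bit_simps flip: bit_Suc)
    have parity: "even (x XOR y) \<longleftrightarrow> (even x \<longleftrightarrow> even y)" for x y :: nat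
      by (simp add: even_xor_iff)
    consider "v div 2 < (a div 2) XOR (b div 2)"
      | "v div 2 = (a div 2) XOR (b div 2)" "even v" "odd a \<noteq> odd b"
      using less.prems unfolding less_div_2_iff[of v] div2 parity by auto
    then show ?thesis
    proof cases
      case 1
      have "a div 2 + b div 2 < a + b" using False by linarith
      from less.hyps[OF this 1] show ?thesis
        by (auto simp: less_div_2_iff[of _ a] less_div_2_iff[of _ b] div2)
    next
      case 2
      \<comment> \<open>The comparison is decided by the lowest bit alone, so whichever of
        \<open>a\<close> and \<open>b\<close> is odd drops by one.\<close>
      have "(v XOR b) div 2 = a div 2" "(a XOR v) div 2 = b div 2"
        unfolding div2 2(1) by (simp add: xor.assoc, simp flip: xor.assoc)
      then show ?thesis
        using 2(2,3) by (auto simp: less_div_2_iff[of _ a] less_div_2_iff[of _ b] parity)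
    qed
  qed
qed

lemma xor_cancel_left [simp]: "a XOR b = a XOR c \<longleftrightarrow> b = c" for a b c :: nat
  by (metis xor.assoc xor.left_neutral xor_self_eq)

lemma xor_cancel_right [simp]: "b XOR a = c XOR a \<longleftrightarrow> b = c" for a b c :: nat
  by (simp add: xor.commute[of _ a])

lemma xor_lessE:
  fixes a b v :: nat
  assumes "v < a XOR b"
  obtains a' where "a' < a" "a' XOR b = v" | b' where "b' < b" "a XOR b' = v"
  using xor_less_cases[OF assms]
  by (metis xor.assoc xor.left_neutral xor.right_neutral xor_self_eq)

lemma nim_sum_simps [simp]:
  "nim_sum [] = 0"
  "nim_sum (x # xs) = x XOR nim_sum xs"
  by (simp_all add: nim_sum_def)

lemma nim_sum_update_eq_iff:
  assumes "i < length xs"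
  shows "nim_sum (xs[i := y]) = nim_sum xs \<longleftrightarrow> y = xs ! i"
  using assms by (induction xs arbitrary: i) (auto split: nat.split)

lemma nim_sum_lessE:
  assumes "v < nim_sum xs"
  obtains i y where "i < length xs" "y < xs ! i" "nim_sum (xs[i := y]) = v"
  using assms
proof (induction xs arbitrary: v thesis)
  case Nil
  then show ?case by simp
next
  case (Cons x xs)
  from Cons.prems(2) have "v < x XOR nim_sum xs" by simp
  then show ?case
  proof (cases rule: xor_lessE)
    case (1 x')
    then show ?thesis using Cons.prems(1)[of 0 x'] by simp
  next
    case (2 w)
    obtain i y where "i < length xs" "y < xs ! i" "nim_sum (xs[i := y]) = w"
      using Cons.IH 2(1) by blast
    then show ?thesis using 2 Cons.prems(1)[of "Suc i" y] by simp
  qed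
qed

section \<open>Mex and the uniqueness of solutions of the mex recursion\<close>

lemma mex_notin:
  assumes "finite A"
  shows "mex A \<notin> A"
  unfolding mex_def by (rule LeastI_ex) (use ex_new_if_finite[OF infinite_UNIV_nat assms] in blast)

lemma less_mex_in: "v < mex A \<Longrightarrow> v \<in> A"
  unfolding mex_def using not_less_Least by blast

lemma mex_eqI:
  assumes "n \<notin> A" "\<And>v. v < n \<Longrightarrow> v \<in> A"
  shows "mex A = n"
  unfolding mex_def using assms by (intro Least_equality) (auto simp: not_less[symmetric])

lemma grundy_option_neq:
  assumes "wf {(q, p). q \<in> opts p}" "finite (opts p)" "q \<in> opts p"
  shows "grundy opts q \<noteq> grundy opts p"
  using mex_notin[of "grundy opts ` opts p"] assms(2,3)
  unfolding grundy_eq[OF assms(1), of p] by (metis finite_imageI imageI)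

lemma less_grundyE:
  assumes "wf {(q, p). q \<in> opts p}" "v < grundy opts p"
  obtains q where "q \<in> opts p" "grundy opts q = v"
  using less_mex_in[of v "grundy opts ` opts p"] assms grundy_eq[OF assms(1), of p] by auto

text \<open>The mex recursion of a well-founded game has a single solution, so a candidate
  \<open>F\<close> need only differ across each move and reach every smaller value. The invariant
  \<open>P\<close> confines the check to legal positions, as the option functions accept arbitrary
  lists.\<close>

lemma grundy_eqI:
  assumes wf: "wf {(q, p). q \<in> opts p}"
    and closed: "\<And>p q. P p \<Longrightarrow> q \<in> opts p \<Longrightarrow> P q"
    and neq: "\<And>p q. P p \<Longrightarrow> q \<in> opts p \<Longrightarrow> F q \<noteq> F p"
    and reach: "\<And>p v. P p \<Longrightarrow> v < F p \<Longrightarrow> \<exists>q \<in> opts p. F q = v"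
    and "P p"
  shows "grundy opts p = F p"
  using wf \<open>P p\<close>
proof (induction p rule: wf_induct_rule)
  case (less p)
  have "grundy opts ` opts p = F ` opts p"
  proof (rule image_cong)
    fix q assume "q \<in> opts p"
    then show "grundy opts q = F q"
      using less.IH[of q] closed[OF less.prems] by simp
  qed simp
  moreover have "mex (F ` opts p) = F p"
  proof (rule mex_eqI)
    show "F p \<notin> F ` opts p"
      unfolding image_iff using neq[OF less.prems] by metis
    show "v \<in> F ` opts p" if "v < F p" for v
      using reach[OF less.prems that] by auto
  qed
  ultimately show ?case by (subst grundy_eq[OF wf]) simp
qed

section \<open>Sprague-Grundy theorem for disjunctive sums\<close>

lemma grundy_sum_opts:
  assumes f: "wf {(q, p). q \<in> f p}" "\<And>p. finite (f p)"
    and g: "wf {(q, p). q \<in> g p}" "\<And>p. finite (g p)"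
  shows "grundy (sum_opts f g) (p, q) = grundy f p XOR grundy g q"
proof -
  let ?F = "\<lambda>(p, q). grundy f p XOR grundy g q"
  have "grundy (sum_opts f g) (p, q) = ?F (p, q)"
  proof (rule grundy_eqI[where P = "\<lambda>_. True"])
    show "wf {(r', r). r' \<in> sum_opts f g r}"
      \<comment> \<open>Moves of the sum descend lexicographically: a move in the second game fixes
        the first component.\<close>
      by (rule wf_subset[OF wf_lex_prod[OF f(1) g(1)]]) (auto simp: sum_opts_def)
  next
    fix r r' assume "r' \<in> sum_opts f g r"
    then show "?F r' \<noteq> ?F r"
      using grundy_option_neq[OF f] grundy_option_neq[OF g] by (auto simp: sum_opts_def)
  next
    fix r v assume "v < ?F r"
    moreover obtain p q where r: "r = (p, q)" by fastforce
    ultimately have "v < grundy f p XOR grundy g q" by simp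
    then show "\<exists>r' \<in> sum_opts f g r. ?F r' = v"
    proof (cases rule: xor_lessE)
      case (1 a)
      then obtain p' where "p' \<in> f p" "grundy f p' = a" by (blast elim: less_grundyE[OF f(1)])
      then have "(p', q) \<in> sum_opts f g r" "?F (p', q) = v" using 1 by (auto simp: sum_opts_def r)
      then show ?thesis by blast
    next
      case (2 b)
      then obtain q' where "q' \<in> g q" "grundy g q' = b" by (blast elim: less_grundyE[OF g(1)])
      then have "(p, q') \<in> sum_opts f g r" "?F (p, q') = v" using 2 by (auto simp: sum_opts_def r)
      then show ?thesis by blast
    qed
  qed auto
  then show ?thesis by simp
qed

text \<open>A move changes one entry and keeps the length, so it is a step of
  \<open>listrel1\<close>, which inherits well-foundedness.\<close>

lemma wf_sum_list_opts:
  assumes "wf {(q, p). q \<in> f p}"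
  shows "wf {(qs, ps). qs \<in> sum_list_opts f ps}"
proof -
  have "{(qs, ps). qs \<in> sum_list_opts f ps} \<subseteq> listrel1 {(q, p). q \<in> f p}"
  proof clarify
    fix qs ps assume "qs \<in> sum_list_opts f ps"
    then obtain i q where "i < length ps" "q \<in> f (ps ! i)" "qs = ps[i := q]"
      by (auto simp: sum_list_opts_def)
    then show "(qs, ps) \<in> listrel1 {(q, p). q \<in> f p}"
      by (intro listrel1I[of q "ps ! i" _ _ "take i ps" "drop (Suc i) ps"])
        (auto simp: upd_conv_take_nth_drop id_take_nth_drop)
  qed
  then show ?thesis using assms wf_listrel1_iff wf_subset by blast
qed

lemma grundy_sum_list_opts:
  assumes wf: "wf {(q, p). q \<in> f p}" and fin: "\<And>p. finite (f p)"
  shows "grundy (sum_list_opts f) ps = nim_sum (map (grundy f) ps)"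
proof (rule grundy_eqI[where P = "\<lambda>_. True"])
  show "wf {(qs, ps). qs \<in> sum_list_opts f ps}"
    by (rule wf_sum_list_opts[OF wf])
next
  fix ps qs assume "qs \<in> sum_list_opts f ps"
  then show "nim_sum (map (grundy f) qs) \<noteq> nim_sum (map (grundy f) ps)"
    using grundy_option_neq[OF wf fin]
    by (auto simp: sum_list_opts_def map_update nim_sum_update_eq_iff)
next
  fix ps v assume "v < nim_sum (map (grundy f) ps)"
  then obtain i y where i: "i < length ps" "y < grundy f (ps ! i)"
      "nim_sum ((map (grundy f) ps)[i := y]) = v"
    by (auto elim: nim_sum_lessE)
  obtain q where "q \<in> f (ps ! i)" "grundy f q = y"
    using i(2) by (rule less_grundyE[OF wf])
  then show "\<exists>qs \<in> sum_list_opts f ps. nim_sum (map (grundy f) qs) = v"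
    using i by (intro bexI[of _ "ps[i := q]"]) (auto simp: sum_list_opts_def map_update)
qed auto

section \<open>Silver Dollar with an even number of tokens\<close>

text \<open>The recursion pairs tokens from the left, which agrees with pairing from the right when
  their number is even, the only case used below. The term \<open>b - Suc a\<close> counts the empty
  squares between two paired tokens.\<close>

fun gap_sum :: "nat list \<Rightarrow> nat" where
  "gap_sum (a # b # r) = (b - Suc a) XOR gap_sum r"
| "gap_sum _ = 0"

text \<open>A token lies in exactly one pair, so only one gap changes. Legality of both lists keeps
  the truncated subtraction exact.\<close>

lemma gap_sum_update_neq:
  assumes "even (length t)" "sd_position t" "sd_position (t[j := c])" "j < length t" "c \<noteq> t ! j"
  shows "gap_sum (t[j := c]) \<noteq> gap_sum t"
  using assms
proof (induction t arbitrary: j rule: gap_sum.induct)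
  case (1 a b r)
  consider "j = 0" | "j = 1" | k where "j = Suc (Suc k)"
    by (metis One_nat_def nat.exhaust)
  then show ?case
    using 1 by cases (auto simp: sd_position_def)
qed auto

text \<open>The moved token is always the right one of its pair. Recording \<open>0 < j\<close> puts
  its left neighbour inside \<open>t\<close>, so the move survives when a head is prepended.\<close>

lemma less_gap_sumE:
  assumes "even (length t)" "sd_position t" "v < gap_sum t"
  obtains j c where "j < length t" "0 < j" "t ! (j - 1) < c" "c < t ! j" "gap_sum (t[j := c]) = v"
  using assms
proof (induction t arbitrary: v thesis rule: gap_sum.induct)
  case (1 a b r)
  from 1(5) have "v < (b - Suc a) XOR gap_sum r" by simp
  then show ?case
  proof (cases rule: xor_lessE)
    case (1 d)
    \<comment> \<open>Moving the right token from \<open>b\<close> to \<open>Suc a + d\<close>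
      leaves a gap of exactly \<open>d\<close>.\<close>
    then show ?thesis
      using "1.prems"(1)[of 1 "Suc a + d"] by simp
  next
    case (2 d)
    obtain j c where "j < length r" "0 < j" "r ! (j - 1) < c" "c < r ! j" "gap_sum (r[j := c]) = d"
      using "1.IH"[of d] "1.prems" 2(1) by (auto simp: sd_position_def)
    then show ?thesis
      using "1.prems"(1)[of "Suc (Suc j)" c] 2 by simp
  qed
qed auto

lemma sd_position_update:
  assumes "sd_position a" "j < length a" "c < a ! j" "j > 0 \<longrightarrow> a ! (j - 1) < c"
  shows "sd_position (a[j := c])"
proof -
  have less: "a ! x < a ! y" if "x < y" "y < length a" for x y
    using assms(1) that unfolding sd_position_def by (rule sorted_wrt_nth_less)
  have "a[j := c] ! k < a[j := c] ! l" if "k < l" "l < length a" for k l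
  proof (cases "l = j")
    case True
    have "a ! k \<le> a ! (j - 1)"
      using less[of k "j - 1"] True that by (cases "k = j - 1") (simp, force)
    then show ?thesis using True assms(4) that by simp
  next
    case False
    then show ?thesis using less[OF that] assms(3) that by (cases "k = j") auto
  qed
  then show ?thesis by (simp add: sd_position_def sorted_wrt_iff_nth_less)
qed

lemma sd_position_option: "sd_position a \<Longrightarrow> b \<in> sd_opts a \<Longrightarrow> sd_position b"
  by (auto simp: sd_opts_def sd_position_update)

lemma length_option: "b \<in> sd_opts a \<Longrightarrow> length b = length a"
  by (auto simp: sd_opts_def)

lemma gap_sum_option_neq:
  assumes "even (length t)" "sd_position t" "t' \<in> sd_opts t"
  shows "gap_sum t' \<noteq> gap_sum t"
proof -
  obtain j c where "t' = t[j := c]" "j < length t" "c < t ! j"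
    using assms(3) by (auto simp: sd_opts_def)
  then show ?thesis
    using assms sd_position_option[OF assms(2,3)] by (simp add: gap_sum_update_neq)
qed

text \<open>Moving the left token of a pair widens its gap. This is harmless, because an option only
  has to differ in value.\<close>

lemma grundy_sd_opts_even:
  assumes "even (length t)" "sd_position t"
  shows "grundy sd_opts t = gap_sum t"
proof (rule grundy_eqI[OF wf_sd_opts, where P = "\<lambda>t. even (length t) \<and> sd_position t"])
  fix t v assume t: "even (length t) \<and> sd_position t" and v: "v < gap_sum t"
  obtain j c where "j < length t" "t ! (j - 1) < c" "c < t ! j" "gap_sum (t[j := c]) = v"
    using t v by (blast elim: less_gap_sumE)
  then show "\<exists>t' \<in> sd_opts t. gap_sum t' = v"
    by (auto simp: sd_opts_def)
qed (use assms in \<open>auto simp: length_option gap_sum_option_neq intro: sd_position_option\<close>)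

section \<open>Heads and tails of strips\<close>

lemma sd_position_append:
  "sd_position (h @ t) \<longleftrightarrow> sd_position h \<and> sd_position t \<and> (\<forall>x \<in> set h. \<forall>y \<in> set t. x < y)"
  by (auto simp: sd_position_def sorted_wrt_append)

lemma sd_opts_append_left: "h' \<in> sd_opts h \<Longrightarrow> h' @ t \<in> sd_opts (h @ t)"
proof -
  assume "h' \<in> sd_opts h"
  then obtain j c where "h' = h[j := c]" "j < length h" "c < h ! j" "j > 0 \<longrightarrow> h ! (j - 1) < c"
    by (auto simp: sd_opts_def)
  then show ?thesis
    unfolding sd_opts_def
    by (intro CollectI exI[of _ j] exI[of _ c]) (auto simp: nth_append list_update_append)
qed

lemma sd_opts_append_right:
  assumes "j < length t" "0 < j" "t ! (j - 1) < c" "c < t ! j"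
  shows "h @ t[j := c] \<in> sd_opts (h @ t)"
  unfolding sd_opts_def
proof (intro CollectI exI conjI)
  show "h @ t[j := c] = (h @ t)[length h + j := c]" by (simp add: list_update_append)
qed (use assms in \<open>auto simp: nth_append\<close>)

text \<open>The tail case retains only that an entry drops. Together with legality of the new strip,
  this suffices to show that the gap Nim-sum changes.\<close>

lemma sd_opts_appendE:
  assumes "s \<in> sd_opts (h @ t)"
  obtains h' where "h' \<in> sd_opts h" "s = h' @ t"
  | j c where "j < length t" "c < t ! j" "s = h @ t[j := c]"
proof -
  obtain j c where j: "s = (h @ t)[j := c]" "j < length (h @ t)" "c < (h @ t) ! j"
      "j > 0 \<longrightarrow> (h @ t) ! (j - 1) < c"
    using assms by (auto simp: sd_opts_def)
  show thesis
  proof (cases "j < length h")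
    case True
    then have "j - 1 < length h" by simp
    with True have "c < h ! j" "j > 0 \<longrightarrow> h ! (j - 1) < c" using j by (simp_all add: nth_append)
    with True have "h[j := c] \<in> sd_opts h" by (auto simp: sd_opts_def)
    then show thesis using that(1) True j by (simp add: list_update_append)
  next
    case False
    then show thesis using that(2)[of "j - length h" c] j
      by (auto simp: nth_append list_update_append)
  qed
qed

lemma strip_head_append_tail [simp]: "strip_head s @ strip_tail s = s"
  by (simp add: strip_head_def strip_tail_def)

lemma even_length_strip_tail [simp]: "s \<noteq> [] \<Longrightarrow> even (length (strip_tail s))"
  by (auto simp: strip_tail_def)

lemma strip_head_eq_Nil [simp]: "strip_head s = [] \<longleftrightarrow> s = []"
  by (simp add: strip_head_def)

text \<open>The cut depends only on the length of the strip, which moves preserve, so a move in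
  either part leaves the cut in place.\<close>

lemma strip_append:
  assumes "length h = length (strip_head s)" "length t = length (strip_tail s)"
  shows "strip_head (h @ t) = h" "strip_tail (h @ t) = t"
proof -
  have "length (h @ t) = length s"
    using assms by (metis length_append strip_head_append_tail)
  moreover have "length h = min (length s) (if odd (length s) then 1 else 2)"
    using assms(1) by (simp add: strip_head_def)
  ultimately show "strip_head (h @ t) = h" "strip_tail (h @ t) = t"
    by (auto simp: strip_head_def strip_tail_def min_def split: if_splits)
qed

lemma sd_position_strip:
  assumes "sd_position s"
  shows "sd_position (strip_head s)" "sd_position (strip_tail s)"
  using assms sd_position_append[of "strip_head s" "strip_tail s"] by simp_all

text \<open>The head is nonempty and its tokens precede those of the tail, so no tail token can
  stand on square 0.\<close>

lemma zero_in_strip_head_iff: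
  assumes "sd_position s" "s \<noteq> []"
  shows "0 \<in> set (strip_head s) \<longleftrightarrow> 0 \<in> set s"
proof -
  have "0 \<notin> set (strip_tail s)"
    using assms sd_position_append[of "strip_head s" "strip_tail s"] hd_in_set[of "strip_head s"]
    by fastforce
  then show ?thesis
    by (metis Un_iff set_append strip_head_append_tail)
qed

text \<open>The strips interact only through the shared square, and the heads alone decide its
  occupancy.\<close>

lemma ssd_position_strip_head_iff:
  assumes "\<forall>s \<in> set S. sd_position s \<and> s \<noteq> []"
  shows "ssd_position (map strip_head S) \<longleftrightarrow> ssd_position S"
proof -
  have "{i. i < length (map strip_head S) \<and> 0 \<in> set (map strip_head S ! i)} =
      {i. i < length S \<and> 0 \<in> set (S ! i)}"
    using assms by (auto simp: zero_in_strip_head_iff)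
  then show ?thesis
    using assms by (simp add: ssd_position_def sd_position_strip)
qed

section \<open>Star Silver Dollar\<close>

text \<open>The shared-square condition is left out, so the property survives every single-strip
  move, even before that move is known to be legal in the star game.\<close>

definition strips_ok :: "nat list list \<Rightarrow> bool" where
  "strips_ok S \<longleftrightarrow> (\<forall>s \<in> set S. sd_position s \<and> s \<noteq> [])"

definition split_value :: "nat list list \<Rightarrow> nat" where
  "split_value S =
    grundy ssd_opts (map strip_head S) XOR nim_sum (map (\<lambda>s. gap_sum (strip_tail s)) S)"

lemma strips_ok_update:
  assumes "strips_ok S" "i < length S" "s \<in> sd_opts (S ! i)"
  shows "strips_ok (S[i := s])"
proof -
  have "sd_position s" "s \<noteq> []"
    using assms sd_position_option[of "S ! i" s] length_option[of s "S ! i"]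
    by (auto simp: strips_ok_def)
  then show ?thesis
    using assms set_update_subset_insert[of S i s] by (auto simp: strips_ok_def)
qed

lemma ssd_opts_updateI:
  assumes "strips_ok S" "i < length S" "s \<in> sd_opts (S ! i)"
    and "ssd_position ((map strip_head S)[i := strip_head s])"
  shows "S[i := s] \<in> ssd_opts S"
  using assms strips_ok_update[OF assms(1-3)] ssd_position_strip_head_iff[of "S[i := s]"]
  by (auto simp: ssd_opts_def strips_ok_def map_update)

text \<open>A move alters one of the two XOR summands and fixes the other, so cancellation gives the
  claim.\<close>

lemma split_value_option_neq:
  assumes "strips_ok S" "T \<in> ssd_opts S"
  shows "split_value T \<noteq> split_value S"
proof -
  obtain i s where i: "i < length S" "s \<in> sd_opts (S ! i)" and T: "T = S[i := s]" "ssd_position T"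
    using assms(2) by (auto simp: ssd_opts_def)
  have Si: "sd_position (S ! i)" "S ! i \<noteq> []"
    using assms(1) i(1) by (auto simp: strips_ok_def)
  have ok: "strips_ok T" using strips_ok_update[OF assms(1) i] T(1) by simp
  have "s \<in> sd_opts (strip_head (S ! i) @ strip_tail (S ! i))" using i by simp
  then show ?thesis
  proof (cases rule: sd_opts_appendE)
    case (1 h)
    then have s: "strip_head s = h" "strip_tail s = strip_tail (S ! i)"
      using strip_append[of h "S ! i"] by (simp_all add: length_option)
    have "ssd_position (map strip_head T)"
      using ok T(2) by (simp add: ssd_position_strip_head_iff strips_ok_def)
    then have "map strip_head T \<in> ssd_opts (map strip_head S)"
      using 1(1) i(1) unfolding ssd_opts_def T(1) map_update s
      by (intro CollectI exI[of _ i] exI[of _ h]) simp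
    then have "grundy ssd_opts (map strip_head T) \<noteq> grundy ssd_opts (map strip_head S)"
      by (rule grundy_option_neq[OF wf_ssd_opts finite_ssd_opts])
    moreover have "map (\<lambda>s. gap_sum (strip_tail s)) T = map (\<lambda>s. gap_sum (strip_tail s)) S"
      using i s by (auto simp: T(1) nth_list_update intro!: nth_equalityI)
    ultimately show ?thesis by (simp add: split_value_def)
  next
    case (2 j c)
    then have s: "strip_head s = strip_head (S ! i)" "strip_tail s = (strip_tail (S ! i))[j := c]"
      using strip_append[of _ "S ! i"] by simp_all
    \<comment> \<open>Legality of the new tail comes from the whole strip \<open>s\<close>, since
      the case itself gives no lower bound on \<open>c\<close>.\<close>
    have "sd_position (strip_tail s)"
      using sd_position_option[OF Si(1) i(2)] by (rule sd_position_strip)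
    then have "gap_sum (strip_tail s) \<noteq> gap_sum (strip_tail (S ! i))"
      using 2 Si unfolding s by (intro gap_sum_update_neq) (auto simp: sd_position_strip)
    moreover have "map strip_head T = map strip_head S"
      using i s by (auto simp: T(1) nth_list_update intro!: nth_equalityI)
    ultimately show ?thesis
      using i by (simp add: split_value_def T(1) map_update nim_sum_update_eq_iff)
  qed
qed

lemma less_split_value:
  assumes "strips_ok S" "ssd_position S" "v < split_value S"
  shows "\<exists>T \<in> ssd_opts S. split_value T = v"
  using assms(3) unfolding split_value_def[of S]
proof (cases rule: xor_lessE)
  case (1 a)
  then obtain H where "H \<in> ssd_opts (map strip_head S)" and a: "grundy ssd_opts H = a"
    by (blast elim: less_grundyE[OF wf_ssd_opts])
  then obtain i h where i: "i < length S" "h \<in> sd_opts (strip_head (S ! i))"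
      and H: "H = (map strip_head S)[i := h]" "ssd_position H"
    by (auto simp: ssd_opts_def)
  \<comment> \<open>The head option is lifted to the full strip by reattaching the old tail.\<close>
  define s where "s = h @ strip_tail (S ! i)"
  have s: "strip_head s = h" "strip_tail s = strip_tail (S ! i)"
    using i(2) strip_append[of h "S ! i"] by (simp_all add: s_def length_option)
  have "s \<in> sd_opts (S ! i)"
    using sd_opts_append_left[OF i(2), of "strip_tail (S ! i)"] by (simp add: s_def)
  then have "S[i := s] \<in> ssd_opts S"
    using assms(1) i(1) H s by (intro ssd_opts_updateI) simp_all
  moreover have "map (\<lambda>s. gap_sum (strip_tail s)) (S[i := s]) = map (\<lambda>s. gap_sum (strip_tail s)) S"
    using i s by (auto simp: nth_list_update intro!: nth_equalityI)
  then have "split_value (S[i := s]) = v"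
    using 1(2) a by (simp add: split_value_def map_update s H(1))
  ultimately show ?thesis by blast
next
  case (2 b)
  then obtain i y where i: "i < length S" "y < gap_sum (strip_tail (S ! i))"
      and b: "nim_sum ((map (\<lambda>s. gap_sum (strip_tail s)) S)[i := y]) = b"
    by (auto elim: nim_sum_lessE)
  have Si: "sd_position (S ! i)" "S ! i \<noteq> []"
    using assms(1) i(1) by (auto simp: strips_ok_def)
  obtain j c where j: "j < length (strip_tail (S ! i))" "0 < j"
      "strip_tail (S ! i) ! (j - 1) < c" "c < strip_tail (S ! i) ! j"
    and y: "gap_sum ((strip_tail (S ! i))[j := c]) = y"
    using less_gap_sumE[OF _ _ i(2)] Si by (metis even_length_strip_tail sd_position_strip(2))
  define s where "s = strip_head (S ! i) @ (strip_tail (S ! i))[j := c]"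
  have s: "strip_head s = strip_head (S ! i)" "strip_tail s = (strip_tail (S ! i))[j := c]"
    using strip_append[of _ "S ! i"] by (simp_all add: s_def)
  have heads: "map strip_head (S[i := s]) = map strip_head S"
    using i s by (auto simp: nth_list_update intro!: nth_equalityI)
  have "s \<in> sd_opts (S ! i)"
    using sd_opts_append_right[OF j, of "strip_head (S ! i)"] by (simp add: s_def)
  \<comment> \<open>The heads are unchanged, so the shared-square condition carries over from
    \<open>S\<close>.\<close>
  then have "S[i := s] \<in> ssd_opts S"
    using assms(1,2) i(1) heads ssd_position_strip_head_iff[of S]
    by (intro ssd_opts_updateI) (simp_all add: map_update strips_ok_def)
  moreover have "split_value (S[i := s]) = v"
    using 2(2) b y unfolding split_value_def heads by (simp add: map_update s)
  ultimately show ?thesis by blast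
qed

lemma grundy_ssd_opts_split_value:
  assumes "strips_ok S" "ssd_position S"
  shows "grundy ssd_opts S = split_value S"
proof (rule grundy_eqI[OF wf_ssd_opts, where P = "\<lambda>S. strips_ok S \<and> ssd_position S"])
  fix S T assume "strips_ok S \<and> ssd_position S" "T \<in> ssd_opts S"
  then show "strips_ok T \<and> ssd_position T"
    by (auto simp: ssd_opts_def strips_ok_update)
qed (use assms split_value_option_neq less_split_value in blast)+

theorem theorem2:
  fixes S :: "nat list list"
  assumes "length S \<ge> 1"
    and "ssd_position S"
    and "\<forall>s \<in> set S. length s \<ge> 1"
  shows "grundy ssd_opts S =
      Bit_Operations.xor (grundy ssd_opts (map strip_head S))
        (nim_sum (map (\<lambda>s. grundy sd_opts (strip_tail s)) S))
    \<and> grundy ssd_opts S =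
      grundy (sum_opts ssd_opts (sum_list_opts sd_opts)) (map strip_head S, map strip_tail S)"
proof -
  have ok: "strips_ok S"
    using assms by (fastforce simp: strips_ok_def ssd_position_def)
  \<comment> \<open>Tails of nonempty strips have even length, so \<open>gap_sum\<close> is their
    Sprague-Grundy value.\<close>
  then have "map (\<lambda>s. gap_sum (strip_tail s)) S = map (\<lambda>s. grundy sd_opts (strip_tail s)) S"
    by (auto simp: strips_ok_def grundy_sd_opts_even sd_position_strip)
  then have split: "grundy ssd_opts S = grundy ssd_opts (map strip_head S) XOR
      nim_sum (map (\<lambda>s. grundy sd_opts (strip_tail s)) S)"
    using grundy_ssd_opts_split_value[OF ok assms(2)] by (simp only: split_value_def)
  \<comment> \<open>For the second claim, the Sprague-Grundy theorem evaluates the disjunctive sum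
    to the same Nim-sum; it requires finite option sets.\<close>
  have "finite (sum_list_opts sd_opts ts)" for ts
    unfolding sum_list_opts_def by (intro finite_update finite_sd_opts)
  then have "grundy (sum_opts ssd_opts (sum_list_opts sd_opts))
        (map strip_head S, map strip_tail S) =
      grundy ssd_opts (map strip_head S) XOR
        nim_sum (map (grundy sd_opts) (map strip_tail S))"
    by (simp add: grundy_sum_opts grundy_sum_list_opts wf_ssd_opts finite_ssd_opts
        wf_sum_list_opts wf_sd_opts finite_sd_opts del: map_map)
  with split show ?thesis by (simp add: o_def)
qed

end
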